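(* For every integer $k\ge4$, the class $\mathcal{L}_k$ of permutations that are sums of at most $k$ decreasing permutations is $3$-composable.
   Context: A permutation of order $n$ is a bijection $\pi:[n]\to[n]$, where $[n]=\{1,\dots,n\}$, also viewed as the sequence $\pi(1),\dots,\pi(n)$; the empty permutation is allowed. A permutation $\pi$ is contained in $\sigma$ if $\sigma$ has a (not necessarily contiguous) subsequence in the same relative order as $\pi$. A permutation class is a set of permutations closed downwards under containment. For permutations of the same order, $(\pi\circ\sigma)(i)=\pi(\sigma(i))$. For permutation classes, $\mathcal{A}\circ\mathcal{B}=\{\pi\circ\varphi : \pi\in\mathcal{A},\varphi\in\mathcal{B},|\pi|=|\varphi|\}$; this is an associative operation on permutation classes. A class $\mathcal{C}$ is $m$-composable if there are permutation classes $\mathcal{C}_1,\dots,\mathcal{C}_m\subsetneq\mathcal{C}$ (repetitions allowed) with $\mathcal{C}\subseteq\mathcal{C}_1\circ\cdots\circ\mathcal{C}_m$. The sum $\pi\oplus\sigma$ of $\pi$ of order $k$ and $\sigma$ of order $l$ is the permutation $\pi(1),\dots,\pi(k),\sigma(1)+k,\dots,\sigma(l)+k$. A permutation is decreasing if it is $n,n-1,\dots,1$ for some $n$. *)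

theory Defs
  imports "HOL-Combinatorics.Combinatorics" "HOL-Library.Sublist"
begin

text \<open>
  A permutation of order \<open>n\<close> is represented by its one-line notation
  \<open>[\<pi>(1), \<dots>, \<pi>(n)]\<close>. List indices start at 0, so \<open>\<pi>(i)\<close> is \<open>\<pi> ! (i - 1)\<close>.
  The empty list is the empty permutation.
\<close>

type_synonym perm = "nat list"

definition is_perm :: "perm \<Rightarrow> bool" where
  "is_perm \<pi> \<longleftrightarrow> \<pi> \<in> permutations_of_set {1..length \<pi>}"

definition same_order :: "nat list \<Rightarrow> nat list \<Rightarrow> bool" where
  "same_order xs ys \<longleftrightarrow> length xs = length ys \<and>
     (\<forall>i < length xs. \<forall>j < length xs. xs ! i < xs ! j \<longleftrightarrow> ys ! i < ys ! j)"

definition contained :: "perm \<Rightarrow> perm \<Rightarrow> bool" where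
  "contained \<pi> \<sigma> \<longleftrightarrow> (\<exists>\<tau>. subseq \<tau> \<sigma> \<and> same_order \<pi> \<tau>)"

definition perm_class :: "perm set \<Rightarrow> bool" where
  "perm_class C \<longleftrightarrow> (\<forall>\<sigma> \<in> C. is_perm \<sigma>) \<and>
     (\<forall>\<sigma> \<in> C. \<forall>\<pi>. is_perm \<pi> \<and> contained \<pi> \<sigma> \<longrightarrow> \<pi> \<in> C)"

text \<open>Meaningful for permutations of the same order: \<open>(\<pi> \<circ> \<sigma>)(i) = \<pi>(\<sigma>(i))\<close>.\<close>

definition perm_comp :: "perm \<Rightarrow> perm \<Rightarrow> perm" where
  "perm_comp \<pi> \<sigma> = map (\<lambda>v. \<pi> ! (v - 1)) \<sigma>"

definition class_comp :: "perm set \<Rightarrow> perm set \<Rightarrow> perm set" where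
  "class_comp A B = {perm_comp \<pi> \<phi> | \<pi> \<phi>. \<pi> \<in> A \<and> \<phi> \<in> B \<and> length \<pi> = length \<phi>}"

text \<open>
  The class of all identity permutations is neutral for composition of classes
  (lemma \<open>class_comp_id_class\<close>). It serves as the start value of the iterated composition,
  so that the composition of \<open>[A, B, C]\<close> is \<open>A \<circ> (B \<circ> C)\<close>.
\<close>

definition id_class :: "perm set" where
  "id_class = {[1..<Suc n] | n. True}"

definition class_comps :: "perm set list \<Rightarrow> perm set" where
  "class_comps Cs = foldr class_comp Cs id_class"

definition composable :: "nat \<Rightarrow> perm set \<Rightarrow> bool" where
  "composable m C \<longleftrightarrow> perm_class C \<and>
     (\<exists>Cs. length Cs = m \<and> (\<forall>D \<in> set Cs. perm_class D \<and> D \<subset> C) \<and> C \<subseteq> class_comps Cs)"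

definition perm_sum :: "perm \<Rightarrow> perm \<Rightarrow> perm" where
  "perm_sum \<pi> \<sigma> = \<pi> @ map (\<lambda>v. v + length \<pi>) \<sigma>"

definition decreasing :: "perm \<Rightarrow> bool" where
  "decreasing \<pi> \<longleftrightarrow> (\<exists>n. \<pi> = rev [1..<Suc n])"

definition layered_class :: "nat \<Rightarrow> perm set" where
  "layered_class k = {foldr perm_sum \<pi>s [] | \<pi>s. length \<pi>s \<le> k \<and> (\<forall>\<pi> \<in> set \<pi>s. decreasing \<pi>)}"

lemma class_comp_id_class: "class_comp A id_class = A"
proof -
  have id: "perm_comp \<pi> [1..<Suc (length \<pi>)] = \<pi>" for \<pi>
    by (rule nth_equalityI) (simp_all add: perm_comp_def del: upt_Suc)
  have "class_comp A id_class = {perm_comp \<pi> [1..<Suc (length \<pi>)] | \<pi>. \<pi> \<in> A}"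
    unfolding class_comp_def id_class_def by (force simp del: upt_Suc)
  then show ?thesis by (simp only: id) simp
qed

lemma class_comps_three: "class_comps [A, B, C] = class_comp A (class_comp B C)"
  by (simp add: class_comps_def class_comp_id_class)

end

theory Submission
  imports Defs
begin

text \<open>
  If \<open>r\<^sub>n\<close> is the decreasing permutation of order \<open>n\<close>, then \<open>r\<^sub>n \<circ> r\<^sub>n\<close> is the identity.
  For decreasing \<open>\<alpha>, \<beta>, \<gamma>, \<delta>\<close> put \<open>m = |\<alpha>| + |\<beta>|\<close> and \<open>n = |\<gamma>| + |\<delta>|\<close>. As sums are composed
  componentwise and every layered \<open>\<rho>\<close> is an involution, \<open>\<alpha> \<oplus> \<beta> \<oplus> \<gamma> \<oplus> \<delta> \<oplus> \<rho>\<close> equals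
  \<open>(\<alpha> \<oplus> \<beta> \<oplus> r\<^sub>n \<oplus> \<rho>) \<circ> (r\<^sub>m \<oplus> r\<^sub>n \<oplus> \<rho>) \<circ> (r\<^sub>m \<oplus> \<gamma> \<oplus> \<delta> \<oplus> \<rho>)\<close>,
  and each of the three factors has fewer layers than the product. Since empty layers are allowed,
  every element of the class can be written with exactly \<open>k\<close> layers.
\<close>

section \<open>Permutations and decreasing permutations as lists\<close>

lemma is_perm_iff: "is_perm \<pi> \<longleftrightarrow> set \<pi> = {1..length \<pi>} \<and> distinct \<pi>"
  by (simp add: is_perm_def permutations_of_set_def)

text \<open>A list of \<open>n\<close> distinct entries has \<open>n\<close> values, so these fill
  \<open>{1..n}\<close> as soon as they lie in it. This spares a proof of surjectivity.\<close>

lemma is_perm_iff_distinct: "is_perm \<pi> \<longleftrightarrow> distinct \<pi> \<and> set \<pi> \<subseteq> {1..length \<pi>}"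
  by (metis card_atLeastAtMost card_subset_eq diff_Suc_1 distinct_card finite_atLeastAtMost
      is_perm_iff order_refl)

lemma decreasing_is_perm: "decreasing \<pi> \<Longrightarrow> is_perm \<pi>"
  by (auto simp: decreasing_def is_perm_iff simp del: upt_Suc)

lemma decreasing_rev_upt: "decreasing (rev [1..<Suc n])"
  by (auto simp: decreasing_def)

lemma decreasing_Nil: "decreasing []"
  unfolding decreasing_def by (rule exI[of _ 0]) simp

text \<open>The reversed list is sorted and distinct with the values of \<open>[1..<Suc n]\<close>,
  and such a list is unique. The order condition, unlike the explicit list, passes to subsequences
  and patterns.\<close>

lemma decreasing_iff: "decreasing \<pi> \<longleftrightarrow> is_perm \<pi> \<and> sorted_wrt (>) \<pi>"
proof
  assume "decreasing \<pi>"
  then show "is_perm \<pi> \<and> sorted_wrt (>) \<pi>"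
    using decreasing_is_perm
    by (auto simp: decreasing_def sorted_wrt_rev simp del: upt_Suc)
next
  assume *: "is_perm \<pi> \<and> sorted_wrt (>) \<pi>"
  have "sorted_wrt (<) (rev \<pi>)"
    using * by (simp add: sorted_wrt_rev)
  then have sd: "sorted (rev \<pi>)" "distinct (rev \<pi>)"
    by (simp_all only: strict_sorted_iff)
  have "set (rev \<pi>) = set [1..<Suc (length \<pi>)]"
    using * by (simp add: is_perm_iff atLeastLessThanSuc_atLeastAtMost del: upt_Suc)
  with sd have "rev \<pi> = [1..<Suc (length \<pi>)]"
    by (intro sorted_distinct_set_unique sorted_upt distinct_upt)
  then have "\<pi> = rev [1..<Suc (length \<pi>)]"
    by (metis rev_rev_ident)
  then show "decreasing \<pi>"
    unfolding decreasing_def by (rule exI)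
qed

section \<open>Sums and compositions\<close>

lemma length_perm_sum [simp]: "length (perm_sum \<pi> \<sigma>) = length \<pi> + length \<sigma>"
  by (simp add: perm_sum_def)

lemma perm_sum_Nil_left [simp]: "perm_sum [] \<sigma> = \<sigma>"
  by (simp add: perm_sum_def)

lemma perm_sum_assoc: "perm_sum (perm_sum \<pi> \<sigma>) \<tau> = perm_sum \<pi> (perm_sum \<sigma> \<tau>)"
  by (simp add: perm_sum_def add.commute add.left_commute)

lemma perm_sum_id: "perm_sum [1..<Suc m] [1..<Suc n] = [1..<Suc (m + n)]"
  by (rule nth_equalityI) (auto simp: perm_sum_def nth_append simp del: upt_Suc)

lemma is_perm_sum:
  assumes "is_perm \<pi>" "is_perm \<sigma>"
  shows "is_perm (perm_sum \<pi> \<sigma>)"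
proof -
  have "distinct (map (\<lambda>v. v + length \<pi>) \<sigma>)"
    using assms by (simp add: is_perm_iff distinct_map inj_on_def)
  moreover have "set \<pi> \<inter> (\<lambda>v. v + length \<pi>) ` set \<sigma> = {}"
    using assms by (auto simp: is_perm_iff)
  ultimately show ?thesis
    using assms by (auto simp: is_perm_iff_distinct perm_sum_def)
qed

lemma length_perm_comp [simp]: "length (perm_comp \<pi> \<sigma>) = length \<sigma>"
  by (simp add: perm_comp_def)

lemma perm_comp_id_right: "perm_comp \<pi> [1..<Suc (length \<pi>)] = \<pi>"
  by (rule nth_equalityI) (simp_all add: perm_comp_def del: upt_Suc)

lemma perm_comp_id_left:
  assumes "is_perm \<sigma>"
  shows "perm_comp [1..<Suc (length \<sigma>)] \<sigma> = \<sigma>"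
proof -
  have "[1..<Suc (length \<sigma>)] ! (v - 1) = v" if "v \<in> set \<sigma>" for v
    using that assms by (auto simp: is_perm_iff simp del: upt_Suc)
  then show ?thesis
    by (simp add: perm_comp_def map_idI del: upt_Suc)
qed

lemma perm_comp_assoc:
  assumes "is_perm \<tau>" "length \<sigma> = length \<tau>"
  shows "perm_comp (perm_comp \<pi> \<sigma>) \<tau> = perm_comp \<pi> (perm_comp \<sigma> \<tau>)"
proof -
  have "v - 1 < length \<sigma>" if "v \<in> set \<tau>" for v
    using that assms by (auto simp: is_perm_iff)
  then show ?thesis
    by (simp add: perm_comp_def)
qed

text \<open>Entries of \<pi>' point into the block \<pi>, shifted entries of \<sigma>' into the
  block \<sigma>, so the blocks never mix.\<close>

lemma perm_comp_sum:
  assumes "is_perm \<pi>'" "is_perm \<sigma>'" "length \<pi> = length \<pi>'" "length \<sigma> = length \<sigma>'"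
  shows "perm_comp (perm_sum \<pi> \<sigma>) (perm_sum \<pi>' \<sigma>') =
    perm_sum (perm_comp \<pi> \<pi>') (perm_comp \<sigma> \<sigma>')"
proof -
  have "v - 1 < length \<pi>" if "v \<in> set \<pi>'" for v
    using that assms by (auto simp: is_perm_iff)
  \<comment> \<open>Entries are at least 1, so subtracting 1 before or after the shift gives the
    same position.\<close>
  moreover have "v + length \<pi>' - 1 = length \<pi> + (v - 1) \<and> v - 1 < length \<sigma>"
    if "v \<in> set \<sigma>'" for v
    using that assms by (auto simp: is_perm_iff)
  ultimately show ?thesis
    using assms by (simp add: perm_comp_def perm_sum_def nth_append)
qed

section \<open>Decreasing and layered permutations are involutions\<close>

lemma decreasing_involutive:
  assumes "decreasing \<pi>"
  shows "perm_comp \<pi> \<pi> = [1..<Suc (length \<pi>)]"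
proof -
  obtain n where "\<pi> = rev [1..<Suc n]"
    using assms by (auto simp only: decreasing_def)
  then show ?thesis
    by (intro nth_equalityI) (auto simp: perm_comp_def rev_nth simp del: upt_Suc)
qed

lemma layered_is_perm: "\<forall>\<pi> \<in> set \<pi>s. decreasing \<pi> \<Longrightarrow> is_perm (foldr perm_sum \<pi>s [])"
  by (induction \<pi>s) (auto simp: decreasing_is_perm is_perm_sum, simp add: is_perm_iff)

text \<open>Each layer is an involution and sums compose blockwise. This later cancels two of the
  three copies of the common tail \<rho>.\<close>

lemma layered_involutive:
  assumes "\<forall>\<pi> \<in> set \<pi>s. decreasing \<pi>"
  shows "perm_comp (foldr perm_sum \<pi>s []) (foldr perm_sum \<pi>s []) =
    [1..<Suc (length (foldr perm_sum \<pi>s []))]"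
  using assms
proof (induction \<pi>s)
  case Nil
  then show ?case by (simp add: perm_comp_def)
next
  case (Cons \<pi> \<pi>s)
  then have "is_perm \<pi>" "is_perm (foldr perm_sum \<pi>s [])"
    by (simp_all add: decreasing_is_perm layered_is_perm)
  with Cons show ?case
    by (simp add: perm_comp_sum decreasing_involutive perm_sum_id del: upt_Suc One_nat_def)
qed

section \<open>Membership in the layered classes\<close>

lemma layered_classI:
  "length \<pi>s \<le> k \<Longrightarrow> \<forall>\<pi> \<in> set \<pi>s. decreasing \<pi> \<Longrightarrow> foldr perm_sum \<pi>s [] \<in> layered_class k"
  by (auto simp: layered_class_def)

lemma layered_class_mono: "k \<le> l \<Longrightarrow> layered_class k \<subseteq> layered_class l"
  by (fastforce simp: layered_class_def)

text \<open>The empty permutation is decreasing and neutral for sums, so missing layers are padded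
  by \<open>[]\<close>.\<close>

lemma layered_class_exact:
  assumes "\<sigma> \<in> layered_class k"
  obtains \<pi>s where "length \<pi>s = k" "\<forall>\<pi> \<in> set \<pi>s. decreasing \<pi>" "\<sigma> = foldr perm_sum \<pi>s []"
proof -
  obtain \<pi>s where \<pi>s: "length \<pi>s \<le> k" "\<forall>\<pi> \<in> set \<pi>s. decreasing \<pi>" "\<sigma> = foldr perm_sum \<pi>s []"
    using assms by (auto simp: layered_class_def)
  have "foldr perm_sum (replicate m []) \<tau> = \<tau>" for m \<tau>
    by (induction m) simp_all
  then have "\<sigma> = foldr perm_sum (replicate (k - length \<pi>s) [] @ \<pi>s) []"
    using \<pi>s(3) by (simp only: foldr_append comp_apply)
  then show thesis
    using \<pi>s(1,2)
    by (intro that[of "replicate (k - length \<pi>s) [] @ \<pi>s"]) (auto simp: decreasing_Nil)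
qed

section \<open>Closure of the layered classes under containment\<close>

lemma is_perm_append_less:
  assumes "is_perm (\<pi> @ \<sigma>)" "\<And>x y. x \<in> set \<pi> \<Longrightarrow> y \<in> set \<sigma> \<Longrightarrow> x < y"
  obtains \<rho> where "is_perm \<pi>" "is_perm \<rho>" "\<sigma> = map (\<lambda>v. v + length \<pi>) \<rho>"
proof -
  let ?m = "length \<pi>"
  have dist: "distinct \<pi>" "distinct \<sigma>" and un: "set \<pi> \<union> set \<sigma> = {1..?m + length \<sigma>}"
    using assms(1) by (auto simp: is_perm_iff)
  have "set \<pi> \<subseteq> {1..?m}"
  proof
    fix x assume x: "x \<in> set \<pi>"
    then have "x \<le> ?m + length \<sigma>"
      using un by auto
    then have "{1..x} \<subseteq> set \<pi> \<union> set \<sigma>"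
      using un by auto
    \<comment> \<open>All values in \<sigma> exceed \<open>x\<close>, so the values up to
      \<open>x\<close> all occur in \<pi>; counting them bounds \<open>x\<close> by the length of
      \<pi>.\<close>
    then have "{1..x} \<subseteq> set \<pi>"
      using assms(2)[OF x] by fastforce
    then have "x \<le> ?m"
      using card_mono[of "set \<pi>" "{1..x}"] card_length[of \<pi>] by simp
    then show "x \<in> {1..?m}"
      using x un by auto
  qed
  then have \<pi>: "is_perm \<pi>"
    using dist by (simp add: is_perm_iff_distinct)
  have \<sigma>: "set \<sigma> = {Suc ?m..?m + length \<sigma>}"
  proof -
    have "set \<sigma> = (set \<pi> \<union> set \<sigma>) - set \<pi>"
      using assms(1) by (auto simp: is_perm_iff)
    also have "\<dots> = {1..?m + length \<sigma>} - {1..?m}"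
      using un \<pi> by (simp add: is_perm_iff)
    also have "\<dots> = {Suc ?m..?m + length \<sigma>}"
      by auto
    finally show ?thesis .
  qed
  define \<rho> where "\<rho> = map (\<lambda>v. v - ?m) \<sigma>"
  \<comment> \<open>All values of \<sigma> exceed \<open>?m\<close>, so the subtraction is never
    truncated at 0.\<close>
  have "inj_on (\<lambda>v. v - ?m) (set \<sigma>)"
    unfolding \<sigma> by (auto intro!: inj_onI)
  then have "is_perm \<rho>"
    using \<sigma> dist by (auto simp: is_perm_iff_distinct \<rho>_def distinct_map)
  moreover have "\<sigma> = map (\<lambda>v. v + ?m) \<rho>"
    unfolding \<rho>_def map_map by (rule map_idI[symmetric]) (simp add: \<sigma>)
  ultimately show thesis
    using \<pi> that by blast
qed

text \<open>Cuts a pattern and its occurrence at the same position. Comparing positions within a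
  part gives the first two claims, comparing across the cut gives the third.\<close>

lemma same_order_append:
  assumes "same_order (\<pi> @ \<sigma>) (\<tau> @ \<upsilon>)" "length \<pi> = length \<tau>"
  shows "same_order \<pi> \<tau>" "same_order \<sigma> \<upsilon>"
    "(\<And>x y. x \<in> set \<tau> \<Longrightarrow> y \<in> set \<upsilon> \<Longrightarrow> x < y) \<Longrightarrow> x \<in> set \<pi> \<Longrightarrow> y \<in> set \<sigma> \<Longrightarrow> x < y"
proof -
  let ?m = "length \<pi>"
  have len: "length \<sigma> = length \<upsilon>"
    using assms by (simp add: same_order_def)
  have *: "(\<pi> @ \<sigma>) ! i < (\<pi> @ \<sigma>) ! j \<longleftrightarrow> (\<tau> @ \<upsilon>) ! i < (\<tau> @ \<upsilon>) ! j"
    if "i < ?m + length \<sigma>" "j < ?m + length \<sigma>" for i j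
    using assms that by (simp add: same_order_def)
  show "same_order \<pi> \<tau>"
    unfolding same_order_def
  proof (intro conjI allI impI)
    fix i j assume "i < ?m" "j < ?m"
    then show "\<pi> ! i < \<pi> ! j \<longleftrightarrow> \<tau> ! i < \<tau> ! j"
      using *[of i j] assms(2) by (simp add: nth_append)
  qed (rule assms(2))
  show "same_order \<sigma> \<upsilon>"
    unfolding same_order_def
  proof (intro conjI allI impI)
    fix i j assume "i < length \<sigma>" "j < length \<sigma>"
    then show "\<sigma> ! i < \<sigma> ! j \<longleftrightarrow> \<upsilon> ! i < \<upsilon> ! j"
      using *[of "?m + i" "?m + j"] assms(2) by (simp add: nth_append)
  qed (rule len)
  show "x < y" if less: "\<And>x y. x \<in> set \<tau> \<Longrightarrow> y \<in> set \<upsilon> \<Longrightarrow> x < y" and xy: "x \<in> set \<pi>" "y \<in> set \<sigma>"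
  proof -
    obtain i j where "i < ?m" "x = \<pi> ! i" "j < length \<sigma>" "y = \<sigma> ! j"
      using xy by (metis in_set_conv_nth)
    then show ?thesis
      using *[of i "?m + j"] assms(2) len less[of "\<tau> ! i" "\<upsilon> ! j"] by (simp add: nth_append)
  qed
qed

lemma same_order_sorted_wrt_greater:
  "same_order \<pi> \<tau> \<Longrightarrow> sorted_wrt (>) \<tau> \<Longrightarrow> sorted_wrt (>) \<pi>"
  by (simp add: same_order_def sorted_wrt_iff_nth_less)

lemma subseq_sorted_wrt: "subseq \<tau> \<sigma> \<Longrightarrow> sorted_wrt P \<sigma> \<Longrightarrow> sorted_wrt P \<tau>"
  by (induction rule: list_emb.induct) (auto dest: list_emb_set)

text \<open>A pattern meets each layer in a decreasing, possibly empty, block. Keeping empty blocks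
  makes the number of layers exactly the same, which suits the induction.\<close>

lemma contained_layered:
  assumes "\<forall>\<delta> \<in> set \<delta>s. decreasing \<delta>" "is_perm \<pi>" "contained \<pi> (foldr perm_sum \<delta>s [])"
  shows "\<exists>\<delta>s'. length \<delta>s' = length \<delta>s \<and> (\<forall>\<delta> \<in> set \<delta>s'. decreasing \<delta>) \<and> \<pi> = foldr perm_sum \<delta>s' []"
  using assms
proof (induction \<delta>s arbitrary: \<pi>)
  case Nil
  then have "\<pi> = []"
    by (auto simp: contained_def same_order_def dest: list_emb_Nil2)
  then show ?case by simp
next
  case (Cons \<delta> \<delta>s)
  let ?\<rho> = "foldr perm_sum \<delta>s []"
  have \<delta>: "is_perm \<delta>" "sorted_wrt (>) \<delta>" and \<rho>: "is_perm ?\<rho>"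
    using Cons.prems(1) by (simp_all add: decreasing_iff layered_is_perm)
  obtain \<tau> where \<tau>: "subseq \<tau> (\<delta> @ map (\<lambda>v. v + length \<delta>) ?\<rho>)" "same_order \<pi> \<tau>"
    using Cons.prems(3) by (auto simp: contained_def perm_sum_def[of \<delta>])
  \<comment> \<open>The occurrence is cut where it leaves the first layer; its second part is then
    shifted back into \<open>?\<rho>\<close>, and \<pi> is cut at the same position.\<close>
  then obtain \<tau>1 \<tau>2' where split: "\<tau> = \<tau>1 @ \<tau>2'" "subseq \<tau>1 \<delta>"
      "subseq \<tau>2' (map (\<lambda>v. v + length \<delta>) ?\<rho>)"
    by (auto simp: subseq_append_iff)
  then obtain \<tau>2 where \<tau>2: "subseq \<tau>2 ?\<rho>" "\<tau>2' = map (\<lambda>v. v + length \<delta>) \<tau>2"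
    by (metis (no_types, lifting) nths_map subseq_conv_nths)
  define \<pi>1 where "\<pi>1 = take (length \<tau>1) \<pi>"
  define \<pi>2' where "\<pi>2' = drop (length \<tau>1) \<pi>"
  have \<pi>: "\<pi> = \<pi>1 @ \<pi>2'" and len: "length \<pi>1 = length \<tau>1"
    using \<tau>(2) split(1) by (auto simp: \<pi>1_def \<pi>2'_def same_order_def)
  have less: "x < y" if xy: "x \<in> set \<tau>1" "y \<in> set \<tau>2'" for x y
  proof -
    obtain v where "y = v + length \<delta>" "v \<in> set ?\<rho>"
      using xy(2) \<tau>2 by (auto dest: list_emb_set)
    moreover have "x \<in> set \<delta>"
      using xy(1) split(2) by (auto dest: list_emb_set)
    ultimately show ?thesis
      using \<delta>(1) \<rho> by (auto simp: is_perm_iff)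
  qed
  have "same_order (\<pi>1 @ \<pi>2') (\<tau>1 @ \<tau>2')"
    using \<tau>(2) by (simp add: \<pi>[symmetric] split(1)[symmetric])
  note so = same_order_append[OF this len]
  \<comment> \<open>By \<open>less\<close> and \<open>so(3)\<close> the cut of \<pi> separates small
    values from large ones, so it is a sum decomposition.\<close>
  obtain \<pi>2 where \<pi>2: "is_perm \<pi>1" "is_perm \<pi>2" "\<pi>2' = map (\<lambda>v. v + length \<pi>1) \<pi>2"
    using is_perm_append_less[of \<pi>1 \<pi>2'] Cons.prems(2) so(3) less by (metis \<pi>)
  have "decreasing \<pi>1"
    using \<pi>2(1) \<delta>(2) so(1) split(2)
    by (auto simp: decreasing_iff intro: same_order_sorted_wrt_greater subseq_sorted_wrt)
  moreover have "same_order \<pi>2 \<tau>2"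
    using so(2) by (auto simp: same_order_def \<pi>2(3) \<tau>2(2))
  then have "contained \<pi>2 ?\<rho>"
    using \<tau>2(1) by (auto simp: contained_def)
  then obtain \<delta>s' where "length \<delta>s' = length \<delta>s" "\<forall>\<delta> \<in> set \<delta>s'. decreasing \<delta>"
      "\<pi>2 = foldr perm_sum \<delta>s' []"
    using Cons.IH[OF _ \<pi>2(2)] Cons.prems(1) by auto
  moreover have "\<pi> = perm_sum \<pi>1 \<pi>2"
    by (simp add: perm_sum_def \<pi> \<pi>2(3))
  ultimately show ?case
    by (intro exI[of _ "\<pi>1 # \<delta>s'"]) auto
qed

lemma perm_class_layered: "perm_class (layered_class k)"
  unfolding perm_class_def
proof (intro conjI ballI allI impI)
  fix \<sigma> assume "\<sigma> \<in> layered_class k"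
  then show "is_perm \<sigma>"
    by (auto simp: layered_class_def layered_is_perm)
next
  fix \<sigma> \<pi> assume \<sigma>: "\<sigma> \<in> layered_class k" and \<pi>: "is_perm \<pi> \<and> contained \<pi> \<sigma>"
  obtain \<pi>s where "length \<pi>s \<le> k" "\<forall>\<pi> \<in> set \<pi>s. decreasing \<pi>" "\<sigma> = foldr perm_sum \<pi>s []"
    using \<sigma> by (auto simp: layered_class_def)
  with contained_layered[of \<pi>s \<pi>] \<pi> show "\<pi> \<in> layered_class k"
    by (auto intro: layered_classI)
qed

section \<open>Strictness of the chain of layered classes\<close>

lemma id_in_layered_class: "[1..<Suc k] \<in> layered_class k"
proof -
  \<comment> \<open>The identity is a sum of \<open>k\<close> layers of order one.\<close>
  have "foldr perm_sum (replicate k [1..<Suc 1]) [] = [1..<Suc k]"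
  proof (induction k)
    case (Suc k)
    then show ?case
      using perm_sum_id[of 1 k] by (simp del: upt_Suc)
  qed simp
  moreover have "decreasing [1..<Suc 1]"
    using decreasing_rev_upt[of 1] by simp
  ultimately show ?thesis
    using layered_classI[of "replicate k [1..<Suc 1]" k] by (auto simp del: upt_Suc)
qed

text \<open>Every layer is both increasing and decreasing here, hence has at most one entry.\<close>

lemma increasing_layered_length:
  assumes "\<forall>\<pi> \<in> set \<pi>s. decreasing \<pi>" "sorted_wrt (<) (foldr perm_sum \<pi>s [])"
  shows "length (foldr perm_sum \<pi>s []) \<le> length \<pi>s"
  using assms
proof (induction \<pi>s)
  case (Cons \<pi> \<pi>s)
  have "sorted_wrt (<) \<pi>" "sorted_wrt (<) (foldr perm_sum \<pi>s [])"
    using Cons.prems(2)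
    by (simp_all add: perm_sum_def[of \<pi>] sorted_wrt_append sorted_wrt_map)
  moreover have "sorted_wrt (>) \<pi>"
    using Cons.prems(1) by (simp add: decreasing_iff)
  \<comment> \<open>The case rule isolates lists with at least two entries, whose first two would
    have to both rise and fall.\<close>
  ultimately have "length \<pi> \<le> 1"
    by (cases \<pi> rule: remdups_adj.cases) auto
  then show ?case
    using Cons \<open>sorted_wrt (<) (foldr perm_sum \<pi>s [])\<close> by simp
qed simp

text \<open>The identity of order \<open>Suc k\<close> separates the classes, as it needs one layer
  per entry.\<close>

lemma layered_class_psubset: "layered_class k \<subset> layered_class (Suc k)"
proof -
  have "[1..<Suc (Suc k)] \<notin> layered_class k"
  proof
    assume "[1..<Suc (Suc k)] \<in> layered_class k"
    then obtain \<pi>s where \<pi>s: "length \<pi>s = k" "\<forall>\<pi> \<in> set \<pi>s. decreasing \<pi>"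
        "[1..<Suc (Suc k)] = foldr perm_sum \<pi>s []"
      by (rule layered_class_exact)
    then show False
      using increasing_layered_length[OF \<pi>s(2)] unfolding \<pi>s(3)[symmetric]
      by (simp del: upt_Suc)
  qed
  then show ?thesis
    using layered_class_mono[of k "Suc k"] id_in_layered_class[of "Suc k"] by auto
qed

section \<open>The factorization into three factors\<close>

lemma class_compI:
  "\<pi> \<in> A \<Longrightarrow> \<phi> \<in> B \<Longrightarrow> length \<pi> = length \<phi> \<Longrightarrow> perm_comp \<pi> \<phi> \<in> class_comp A B"
  by (auto simp: class_comp_def)

text \<open>Here \<open>m\<close> counts the layers of the tail \<rho>. The factors
  \<open>p1\<close>, \<open>p2\<close>, \<open>p3\<close> have \<open>m + 3\<close>,
  \<open>m + 2\<close> and \<open>m + 3\<close> layers, so a single class \<open>C\<close> holds all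
  three.\<close>

lemma layered_class_subset_comps:
  fixes m :: nat
  defines "C \<equiv> layered_class (m + 3)"
  shows "layered_class (m + 4) \<subseteq> class_comps [C, C, C]"
proof
  fix \<sigma> assume "\<sigma> \<in> layered_class (m + 4)"
  then obtain \<pi>s where \<pi>s: "length \<pi>s = m + 4" "\<forall>\<pi> \<in> set \<pi>s. decreasing \<pi>"
      "\<sigma> = foldr perm_sum \<pi>s []"
    by (rule layered_class_exact)
  then obtain a b c d \<rho>s where abcd: "\<pi>s = a # b # c # d # \<rho>s" "length \<rho>s = m"
    by (auto simp: length_Suc_conv numeral_eq_Suc)
  define \<rho> where "\<rho> = foldr perm_sum \<rho>s []"
  define x y where "x = perm_sum a b" and "y = perm_sum c d"
  \<comment> \<open>Decreasing permutations of the orders of \<open>x\<close> and \<open>y\<close>: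
    each replaces two layers by one.\<close>
  define r s where "r = rev [1..<Suc (length x)]" and "s = rev [1..<Suc (length y)]"
  have dec: "decreasing a" "decreasing b" "decreasing c" "decreasing d" "decreasing r"
      "decreasing s" "\<forall>\<pi> \<in> set \<rho>s. decreasing \<pi>"
    using \<pi>s(2) decreasing_rev_upt by (auto simp: abcd r_def s_def simp del: upt_Suc One_nat_def)
  have len: "length r = length x" "length s = length y"
    by (simp_all add: r_def s_def del: upt_Suc One_nat_def)
  have perm: "is_perm x" "is_perm y" "is_perm r" "is_perm s" "is_perm \<rho>"
    using dec by (simp_all add: x_def y_def \<rho>_def decreasing_is_perm is_perm_sum layered_is_perm)
  define p1 p2 p3 where "p1 = perm_sum x (perm_sum s \<rho>)" and "p2 = perm_sum r (perm_sum s \<rho>)"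
    and "p3 = perm_sum r (perm_sum y \<rho>)"
  have "p1 \<in> C"
    using layered_classI[of "a # b # s # \<rho>s" "m + 3"] dec abcd(2)
    by (simp add: C_def p1_def x_def \<rho>_def perm_sum_assoc)
  moreover have "p2 \<in> C"
    using layered_classI[of "r # s # \<rho>s" "m + 3"] dec abcd(2)
    by (simp add: C_def p2_def \<rho>_def)
  moreover have "p3 \<in> C"
    using layered_classI[of "r # c # d # \<rho>s" "m + 3"] dec abcd(2)
    by (simp add: C_def p3_def y_def \<rho>_def perm_sum_assoc)
  ultimately have mem: "perm_comp p1 (perm_comp p2 p3) \<in> class_comps [C, C, C]"
    unfolding class_comps_three
    by (intro class_compI) (simp_all add: p1_def p2_def p3_def len)
  have inv: "perm_comp r r = [1..<Suc (length x)]" "perm_comp s s = [1..<Suc (length y)]"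
      "perm_comp \<rho> \<rho> = [1..<Suc (length \<rho>)]"
    using decreasing_involutive layered_involutive dec len unfolding \<rho>_def by metis+
  \<comment> \<open>\<open>s\<close> and \<rho> cancel against themselves. Their identities merge
    into one block, aligned with the block \<open>perm_sum y \<rho>\<close> of
    \<open>p3\<close>.\<close>
  have p12: "perm_comp p1 p2 = perm_sum (perm_comp x r) [1..<Suc (length y + length \<rho>)]"
    using perm len inv
    by (simp add: p1_def p2_def perm_comp_sum is_perm_sum perm_sum_id del: upt_Suc One_nat_def)
  have "perm_comp p1 (perm_comp p2 p3) = perm_comp (perm_comp p1 p2) p3"
    using perm len by (subst perm_comp_assoc) (simp_all add: p2_def p3_def is_perm_sum)
  also have "\<dots> = perm_sum (perm_comp (perm_comp x r) r)
      (perm_comp [1..<Suc (length y + length \<rho>)] (perm_sum y \<rho>))"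
    using perm len unfolding p12 p3_def
    by (subst perm_comp_sum) (auto simp: is_perm_sum simp del: upt_Suc One_nat_def)
  \<comment> \<open>Reassociating, \<open>r\<close> cancels against itself and leaves
    \<open>x\<close>.\<close>
  also have "\<dots> = perm_sum x (perm_sum y \<rho>)"
    using perm len inv perm_comp_id_left[of "perm_sum y \<rho>"]
    by (simp add: perm_comp_assoc perm_comp_id_right is_perm_sum del: upt_Suc One_nat_def)
  also have "\<dots> = \<sigma>"
    by (simp add: \<pi>s(3) abcd(1) x_def y_def \<rho>_def perm_sum_assoc)
  finally show "\<sigma> \<in> class_comps [C, C, C]"
    using mem by simp
qed

theorem theorem5p5:
  fixes k :: nat
  assumes "k \<ge> 4"
  shows "composable 3 (layered_class k)"
proof -
  obtain m where k: "k = m + 4"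
    using assms by (metis add.commute le_Suc_ex)
  \<comment> \<open>The class with one layer fewer serves as all three factors.\<close>
  let ?C = "layered_class (m + 3)"
  have "?C \<subset> layered_class k"
    using layered_class_psubset[of "m + 3"] by (simp add: k numeral_eq_Suc)
  then show ?thesis
    unfolding composable_def
    using perm_class_layered layered_class_subset_comps[of m]
    by (intro conjI exI[of _ "[?C, ?C, ?C]"]) (auto simp: k)
qed

end
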